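(* With $N=i+j+1$, as $N\to\infty$, $$T_{i,j}=\frac{(\pi i+2j+2)^2}{4\pi}+O\big(N^{4/3}\big),$$ uniformly over all integers $i,j\ge 0$, with an absolute implied constant; that is, there is an absolute constant $C$ such that $\left|T_{i,j}-\frac{(\pi i+2j+2)^2}{4\pi}\right|\le C\,(i+j+1)^{4/3}$ for all integers $i,j\ge0$. In particular, $T_{i,j}=\frac{(\pi i+2j)^2}{4\pi}+o(N^2)$ as $N=i+j+1\to\infty$.
   Context: For each integer $n\ge1$ let $T^{(n)}$ be the array of positive integers with entries $T^{(n)}_{i,j}$ (rows $i\ge0$, columns $0\le j<n$) defined recursively by $T^{(1)}_{q,0}=q+1$ for $q\ge0$, and, for $n\ge1$, $0\le j\le n$ and a row index written uniquely as $i=qn+r$ with $q\ge0$, $0\le r<n$, $$T^{(n+1)}_{qn+r,\,j}=\begin{cases}T^{(n)}_{q(n+1)+r,\,j}, & j+r<n,\\ T^{(n)}_{q(n+1)+r+1,\,j-1}, & j+r\ge n.\end{cases}$$ For fixed $i,j\ge0$ the entry $T^{(n)}_{i,j}$ is independent of $n$ for $n\ge i+j+1$. The Tchoukaillon array is the limiting array $T_{i,j}:=T^{(i+j+1)}_{i,j}$, $i,j\ge0$. *)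

theory Defs
  imports "HOL-Analysis.Analysis" "HOL-Library.Landau_Symbols"
begin

(* tarr n i j is the entry in row i and column j of the n-th array, n >= 1.
   It is meaningful only for j < n (values outside this range are arbitrary and are never
   consulted by the recursion at entries inside the range). In the recursive equation
   i = q * n + r with r < n, that is, q = i div n and r = i mod n. *)
fun tarr :: "nat \<Rightarrow> nat \<Rightarrow> nat \<Rightarrow> nat" where
  "tarr 0 i j = 0"
| "tarr (Suc 0) i j = i + 1"
| "tarr (Suc (Suc m)) i j =
     (let n = Suc m; q = i div n; r = i mod n
      in if j + r < n then tarr n (q * (n + 1) + r) j
         else tarr n (q * (n + 1) + r + 1) (j - 1))"

lemma tarr_one: "tarr 1 q 0 = q + 1"
  by simp

lemma tarr_step:
  assumes "n \<ge> 1" "j \<le> n" "r < n"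
  shows "tarr (n + 1) (q * n + r) j =
    (if j + r < n then tarr n (q * (n + 1) + r) j
     else tarr n (q * (n + 1) + r + 1) (j - 1))"
proof -
  obtain m where m: "n = Suc m"
    using assms(1) by (cases n) auto
  have "(q * n + r) div n = q" "(q * n + r) mod n = r"
    using assms by simp_all
  then show ?thesis
    unfolding m by (simp only: Suc_eq_plus1[symmetric] tarr.simps Let_def)
qed

definition Tchoukaillon :: "nat \<Rightarrow> nat \<Rightarrow> nat" where
  "Tchoukaillon i j = tarr (i + j + 1) i j"

lemma tarr_stable:
  assumes "n \<ge> i + j + 1"
  shows "tarr n i j = Tchoukaillon i j"
  using assms
proof (induction n rule: dec_induct)
  case base
  show ?case by (simp add: Tchoukaillon_def)
next
  case (step n)
  then show ?case
    using tarr_step[of n j i 0] by simp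
qed

end

theory Submission
  imports Defs "HOL-Real_Asymp.Real_Asymp"
begin

text \<open>
  In terms of the row \<open>i\<close> and the sum \<open>s = i + j\<close>, one step of the recursion is the symmetric map
  \<open>(i, s) \<mapsto> (i + s div n, s + i div n)\<close>, applied for \<open>n = s, s - 1, \<dots>, 1\<close>; the entry is then \<open>i + 1\<close>.
  The two quotients increase by one alternately, and between two switches \<open>i\<close> and \<open>s\<close> are affine in \<open>n\<close>.
  The intercepts satisfy exactly \<open>Y (m + 1) = Y (m - 1) + Y m div m\<close> with \<open>Y 0 = i\<close>, \<open>Y 1 = s\<close>,
  and the \<open>m\<close>-th switch takes place at \<open>n = Y m div m\<close>. Without rounding, \<open>Y m = m j / W + i W\<close> for a
  Wallis product \<open>W\<close> with \<open>W\<^sup>2 \<approx> \<pi> m / 2\<close>, so that \<open>Y\<^sup>2 / m \<approx> (\<pi> i + 2 j)\<^sup>2 / (2 \<pi>)\<close>; rounding changes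
  \<open>Y m\<close> by at most \<open>m\<close>. From level \<open>n\<close> on, \<open>(n + 1) (i + s)\<close> varies by at most \<open>n (n + 1)\<close>. Taking
  \<open>m \<sim> N\<close> to the power \<open>2/3\<close> makes \<open>n\<close> of the same order and balances both errors.
\<close>

section \<open>The symmetric sieve step\<close>

text \<open>This carries \<open>a \<le> b \<le> a + n\<close> over to the updated pair, with
  \<open>n - 1\<close> for \<open>n\<close>. A unit more in the dividend adds at most one to the
  quotient; if \<open>b = a + n\<close>, the quotients differ by one, which supplies the missing
  unit.\<close>

lemma div_diff_bounds:
  fixes a b n :: nat
  assumes "a \<le> b" "b \<le> a + n" "n > 0"
  shows "a + b div n \<le> b + a div n" "b + a div n + 1 \<le> a + b div n + n"
proof -
  have "(a + d) div n \<le> a div n + d" for d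
    by (induction d) (simp_all add: div_Suc)
  from this[of "b - a"] show "a + b div n \<le> b + a div n" using assms(1) by simp
  show "b + a div n + 1 \<le> a + b div n + n"
  proof (cases "b = a + n")
    case False
    have "a div n \<le> b div n" using assms(1) by (rule div_le_mono)
    with False assms(2) show ?thesis by linarith
  qed (use assms in simp)
qed

text \<open>The test \<open>j + i mod n < n\<close> decides exactly whether
  \<open>(i + j) div n\<close> equals \<open>i div n\<close> or is one more, so both branches merge
  into one formula.\<close>

lemma tarr_Suc:
  assumes "n > 0" "j \<le> n"
  shows "tarr (Suc n) i j =
    tarr n (i + (i + j) div n) (i + j + i div n - (i + (i + j) div n))"
proof -
  define q r where "q = i div n" and "r = i mod n"
  have i: "i = q * n + r" and r: "r < n"
    using assms unfolding q_def r_def by simp_all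
  have div: "(i + j) div n = q + (if j + r < n then 0 else 1)"
  proof (cases "j + r < n")
    case True
    then show ?thesis unfolding i by (simp add: add.assoc)
  next
    case False
    then have "i + j = (q + 1) * n + (j + r - n)" "j + r - n < n"
      using assms r unfolding i by auto
    then have "(i + j) div n = q + 1" by (metis add.commute div_mult_self3 div_less assms(1) add_0 less_irrefl_nat)
    then show ?thesis using False by simp
  qed
  show ?thesis
  proof (cases "j + r < n")
    case True
    have "i + (i + j) div n = q * (n + 1) + r" "i + j + q - (i + (i + j) div n) = j"
      using True div i by simp_all
    then show ?thesis
      using tarr_step[of n j r q] assms r True unfolding i[symmetric] q_def[symmetric] by simp
  next
    case False
    have "i + (i + j) div n = q * (n + 1) + r + 1" "i + j + q - (i + (i + j) div n) = j - 1"
      using False div i by simp_all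
    then show ?thesis
      using tarr_step[of n j r q] assms r False unfolding i[symmetric] q_def[symmetric] by simp
  qed
qed

declare tarr.simps(3) [simp del]

text \<open>The index is the next divisor, so the iteration runs downward; divisors above
  \<open>s\<close> give quotient 0, hence the constant start.\<close>

locale sieve =
  fixes I S :: "nat \<Rightarrow> nat" and i s :: nat
  assumes i_le_s: "i \<le> s"
    and I_init: "n \<ge> s \<Longrightarrow> I n = i"
    and S_init: "n \<ge> s \<Longrightarrow> S n = s"
    and I_step: "I n = I (Suc n) + S (Suc n) div Suc n"
    and S_step: "S n = S (Suc n) + I (Suc n) div Suc n"

lemma sieve_exists:
  assumes "i \<le> s"
  obtains I S where "sieve I S i s"
proof -
  \<comment> \<open>Time \<open>t = s - n\<close> turns the descent into an ordinary recursion;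
    truncated subtraction sends every \<open>n \<ge> s\<close> to the start.\<close>
  define F where "F = rec_nat (i, s) (\<lambda>t (a, b). (a + b div (s - t), b + a div (s - t)))"
  have F: "F 0 = (i, s)"
    "F (Suc t) = (fst (F t) + snd (F t) div (s - t), snd (F t) + fst (F t) div (s - t))" for t
    unfolding F_def by (simp_all add: case_prod_beta)
  have "sieve (\<lambda>n. fst (F (s - n))) (\<lambda>n. snd (F (s - n))) i s"
  proof
    fix n
    have *: "s - n = Suc (s - Suc n) \<and> s - (s - Suc n) = Suc n" if "n < s"
      using that by simp
    show "fst (F (s - n)) = fst (F (s - Suc n)) + snd (F (s - Suc n)) div Suc n"
      using * F assms by (cases "n < s") auto
    show "snd (F (s - n)) = snd (F (s - Suc n)) + fst (F (s - Suc n)) div Suc n"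
      using * F assms by (cases "n < s") auto
  qed (use assms F in auto)
  then show ?thesis by (rule that)
qed

context sieve
begin

text \<open>So the column \<open>S n - I n\<close> stays inside the array with \<open>n + 1\<close>
  columns, and \<open>I 0 = S 0\<close>.\<close>

lemma I_le_S_le: "I n \<le> S n \<and> S n \<le> I n + n"
proof (cases "n \<le> s")
  case True
  then show ?thesis
  proof (induction n rule: inc_induct)
    case base
    then show ?case using i_le_s I_init[of s] S_init[of s] by simp
  next
    case (step n)
    then show ?case
      using div_diff_bounds[of "I (Suc n)" "S (Suc n)" "Suc n"] I_step[of n] S_step[of n] by simp
  qed
next
  case False
  then show ?thesis using i_le_s I_init[of n] S_init[of n] by simp
qed

lemma Tchoukaillon_eq: "Tchoukaillon i (s - i) = I 0 + 1"
proof -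
  have "n \<le> s \<Longrightarrow> tarr (Suc n) (I n) (S n - I n) = I 0 + 1" for n
  proof (induction n)
    case 0
    then show ?case using I_le_S_le[of 0] by simp
  next
    case (Suc n)
    have "I (Suc n) + (S (Suc n) - I (Suc n)) = S (Suc n)" "S (Suc n) - I (Suc n) \<le> Suc n"
      using I_le_S_le[of "Suc n"] by auto
    then have "tarr (Suc (Suc n)) (I (Suc n)) (S (Suc n) - I (Suc n)) = tarr (Suc n) (I n) (S n - I n)"
      using tarr_Suc[of "Suc n" "S (Suc n) - I (Suc n)" "I (Suc n)"]
      unfolding I_step[of n] S_step[of n] by (simp only: zero_less_Suc)
    with Suc show ?case by simp
  qed
  from this[of s] show ?thesis
    using i_le_s I_init[of s] S_init[of s] by (simp add: Tchoukaillon_def)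
qed

text \<open>Passing from \<open>n\<close> to \<open>n + 1\<close> raises
  \<open>(n + 1) * (I n + S n)\<close> by the remainders of \<open>I (n + 1)\<close> and
  \<open>S (n + 1)\<close> modulo \<open>n + 1\<close>, each at most \<open>n\<close>.\<close>

lemma potential_bounds:
  "2 * I 0 \<le> (n + 1) * (I n + S n)" "(n + 1) * (I n + S n) \<le> 2 * I 0 + n * (n + 1)"
proof -
  have "2 * I 0 \<le> (n + 1) * (I n + S n) \<and> (n + 1) * (I n + S n) \<le> 2 * I 0 + n * (n + 1)"
  proof (induction n)
    case 0
    then show ?case using I_le_S_le[of 0] by simp
  next
    case (Suc n)
    let ?a = "I (Suc n)" and ?b = "S (Suc n)" and ?n = "Suc n"
    have dm: "?n * (x div ?n) \<le> x \<and> x \<le> ?n * (x div ?n) + n" for x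
      using mult_div_mod_eq[of ?n x] mod_less_divisor[of ?n x] by linarith
    have "(n + 1) * (I n + S n) = ?n * (?a + ?b) + (?n * (?a div ?n) + ?n * (?b div ?n))"
      by (simp add: I_step[of n] S_step[of n] algebra_simps)
    moreover have "(?n + 1) * (?a + ?b) = ?n * (?a + ?b) + ?a + ?b" by simp
    moreover have "?n * (?n + 1) = n * (n + 1) + 2 * n + 2" by simp
    ultimately show ?case using Suc dm[of ?a] dm[of ?b] by linarith
  qed
  then show "2 * I 0 \<le> (n + 1) * (I n + S n)"
    "(n + 1) * (I n + S n) \<le> 2 * I 0 + n * (n + 1)" by blast+
qed

end

section \<open>The recursion for the switching levels\<close>

fun switch :: "nat \<Rightarrow> nat \<Rightarrow> nat \<Rightarrow> nat" where
  "switch i s 0 = i"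
| "switch i s (Suc 0) = s"
| "switch i s (Suc (Suc m)) = switch i s m + switch i s (Suc m) div Suc m"

context sieve
begin

definition level :: "nat \<Rightarrow> nat" where "level m = switch i s m div m"

text \<open>With \<open>L = level (Suc m)\<close>, the recursion adds just \<open>L\<close> to
  \<open>switch i s m\<close>, so the result is below \<open>(m + 1) * (L + 1) + L\<close>.\<close>

lemma level_antimono_step:
  assumes "switch i s m \<le> switch i s (Suc m)"
  shows "level (Suc (Suc m)) \<le> level (Suc m)"
proof -
  let ?y = "switch i s (Suc m)"
  have "?y < Suc m * (?y div Suc m + 1)"
    using dividend_less_times_div[of "Suc m" ?y] by simp
  then have "switch i s (Suc (Suc m)) < Suc (Suc m) * (?y div Suc m + 1)"
    using assms by simp
  then have "switch i s (Suc (Suc m)) div Suc (Suc m) < ?y div Suc m + 1"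
    by (simp add: div_less_iff_less_mult mult.commute)
  then show ?thesis by (simp add: level_def)
qed

text \<open>
  \<open>even_phase q\<close> holds while \<open>I div n = S div n = q\<close>, \<open>odd_phase q\<close> while \<open>I div n = q\<close> and
  \<open>S div n = q + 1\<close>; both hold at the switch between them.
\<close>

definition even_phase :: "nat \<Rightarrow> nat \<Rightarrow> bool" where
  "even_phase q n \<longleftrightarrow> I n + q * n = switch i s (2 * q) \<and> S n + q * n = switch i s (2 * q + 1)"

definition odd_phase :: "nat \<Rightarrow> nat \<Rightarrow> bool" where
  "odd_phase q n \<longleftrightarrow>
     S n + q * n = switch i s (2 * q + 1) \<and> I n + (q + 1) * n = switch i s (2 * q + 2)"

text \<open>Not having reached the next switch bounds \<open>S\<close> from above, and being past
  the previous one bounds \<open>I\<close> from below, so both quotients are \<open>q\<close>. For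
  \<open>q = 0\<close> there is no previous switch, and \<open>level 0\<close> is 0 by division by
  zero.\<close>

lemma even_phase_step:
  assumes "even_phase q (Suc n)" "n \<ge> level (2 * q + 1)" "q = 0 \<or> Suc n \<le> level (2 * q)"
  shows "even_phase q n"
proof -
  have "switch i s (2 * q + 1) < (2 * q + 1) * Suc n"
    using assms(2) unfolding level_def
    by (metis Suc_eq_plus1 div_less_iff_less_mult less_Suc_eq_le mult.commute zero_less_Suc)
  then have "S (Suc n) < (q + 1) * Suc n"
    using assms(1) by (simp add: even_phase_def algebra_simps)
  moreover have "q * Suc n \<le> I (Suc n)"
  proof (cases "q = 0")
    case False
    then have "Suc n * (2 * q) \<le> switch i s (2 * q)"
      using assms(3) unfolding level_def by (simp add: less_eq_div_iff_mult_less_eq)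
    then show ?thesis using assms(1) by (simp add: even_phase_def algebra_simps)
  qed simp
  ultimately have "I (Suc n) div Suc n = q" "S (Suc n) div Suc n = q"
    using I_le_S_le[of "Suc n"]
    by (auto intro!: div_nat_eqI simp: algebra_simps)
  then show ?thesis
    using assms(1) unfolding even_phase_def I_step[of n] S_step[of n] by simp
qed

lemma odd_phase_step:
  assumes "odd_phase q (Suc n)" "n \<ge> level (2 * q + 2)" "Suc n \<le> level (2 * q + 1)"
  shows "odd_phase q n"
proof -
  have "switch i s (2 * q + 2) < (2 * q + 2) * Suc n"
    using assms(2) unfolding level_def
    by (metis add_gr_0 div_less_iff_less_mult less_Suc_eq_le mult.commute zero_less_numeral)
  then have "I (Suc n) < (q + 1) * Suc n"
    using assms(1) by (simp add: odd_phase_def algebra_simps)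
  moreover have "(q + 1) * Suc n \<le> S (Suc n)"
  proof -
    have "Suc n * (2 * q + 1) \<le> switch i s (2 * q + 1)"
      using assms(3) unfolding level_def by (simp add: less_eq_div_iff_mult_less_eq)
    then show ?thesis using assms(1) by (simp add: odd_phase_def algebra_simps)
  qed
  ultimately have "I (Suc n) div Suc n = q" "S (Suc n) div Suc n = q + 1"
    using I_le_S_le[of "Suc n"]
    by (auto intro!: div_nat_eqI simp: algebra_simps)
  then show ?thesis
    using assms(1) unfolding odd_phase_def I_step[of n] S_step[of n] by simp
qed

text \<open>Raising the slope of \<open>I\<close> by one adds \<open>n\<close> to its intercept; at
  this level \<open>n\<close> is exactly the quotient in the recursion of
  \<open>switch\<close>.\<close>

lemma even_to_odd: "even_phase q (level (2 * q + 1)) \<Longrightarrow> odd_phase q (level (2 * q + 1))"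
  by (simp add: even_phase_def odd_phase_def level_def)

lemma odd_to_even: "odd_phase q (level (2 * q + 2)) \<Longrightarrow> even_phase (q + 1) (level (2 * q + 2))"
  by (simp add: even_phase_def odd_phase_def level_def)

lemma even_phase_mono: "even_phase q n \<Longrightarrow> switch i s (2 * q) \<le> switch i s (2 * q + 1)"
  using I_le_S_le[of n] by (simp add: even_phase_def)

lemma odd_phase_mono: "odd_phase q n \<Longrightarrow> switch i s (2 * q + 1) \<le> switch i s (2 * q + 2)"
  using I_le_S_le[of n] by (simp add: odd_phase_def)

text \<open>The second conclusion lets the next phase descend from this level to its own
  switch.\<close>

lemma even_to_odd_switch:
  assumes "even_phase q n" "n \<ge> level (2 * q + 1)" "q = 0 \<or> n \<le> level (2 * q)"
  shows "odd_phase q (level (2 * q + 1)) \<and> level (2 * q + 2) \<le> level (2 * q + 1)"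
proof -
  have "even_phase q (level (2 * q + 1))"
    using assms(2,1,3)
  proof (induction n rule: dec_induct)
    case (step n)
    then show ?case using even_phase_step[of q n] by auto
  qed
  then show ?thesis
    using even_to_odd level_antimono_step[of "2 * q"] even_phase_mono[OF assms(1)] by simp
qed

lemma odd_to_even_switch:
  assumes "odd_phase q n" "n \<ge> level (2 * q + 2)" "n \<le> level (2 * q + 1)"
  shows "even_phase (q + 1) (level (2 * q + 2)) \<and> level (2 * q + 3) \<le> level (2 * q + 2)"
proof -
  have "odd_phase q (level (2 * q + 2))"
    using assms(2,1,3)
  proof (induction n rule: dec_induct)
    case (step n)
    then show ?case using odd_phase_step[of q n] by auto
  qed
  then show ?thesis
    using odd_to_even level_antimono_step[of "2 * q + 1"] odd_phase_mono[OF assms(1)]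
    by (simp add: numeral_3_eq_3)
qed

lemma even_phase_switch:
  "even_phase (q + 1) (level (2 * q + 2)) \<and> level (2 * q + 3) \<le> level (2 * q + 2)"
proof (induction q)
  case 0
  \<comment> \<open>The initial state lies at level \<open>s\<close>, which is also the first
    switch, so phase 0 needs no step.\<close>
  have "even_phase 0 s" by (simp add: even_phase_def I_init S_init)
  moreover have "level 1 = s" by (simp add: level_def)
  ultimately show ?case
    using even_to_odd_switch[of 0 s] odd_to_even_switch[of 0 s] by simp
next
  case (Suc q)
  let ?n = "level (2 * q + 2)"
  have "odd_phase (q + 1) (level (2 * q + 3)) \<and> level (2 * q + 4) \<le> level (2 * q + 3)"
    using even_to_odd_switch[of "q + 1" ?n] Suc by (simp add: numeral_eq_Suc)
  then show ?case
    using odd_to_even_switch[of "q + 1" "level (2 * q + 3)"] by (simp add: numeral_eq_Suc)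
qed

text \<open>At an even switch \<open>2 * I n = 2 * Y - 2 * k * n\<close> lies between
  \<open>Y\<close> and \<open>Y + 2 * k\<close>, and \<open>S n\<close> exceeds \<open>I n\<close>
  by at most \<open>n\<close>; the potential transfers this to \<open>I 0\<close>.\<close>

lemma I_0_approx:
  assumes "k > 0"
  defines "Y \<equiv> switch i s (2 * k)"
  defines "n \<equiv> Y div (2 * k)"
  shows "(n + 1) * Y \<le> 2 * I 0 + n * (n + 1)"
    "2 * I 0 \<le> (n + 1) * (Y + n + 2 * k)"
proof -
  have n: "n = level (2 * k)" by (simp add: n_def Y_def level_def)
  obtain q where "k = q + 1" using assms(1) by (metis Suc_eq_plus1 gr0_implies_Suc)
  then have ev: "even_phase k n"
    using even_phase_switch[of q] n by simp
  have "2 * k * n \<le> Y" "Y \<le> 2 * k * n + 2 * k"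
    using assms(1) dividend_less_times_div[of "2 * k" Y] unfolding n_def by auto
  then have "Y \<le> I n + S n" "I n + S n \<le> Y + n + 2 * k"
    using ev I_le_S_le[of n] unfolding even_phase_def Y_def[symmetric] by linarith+
  then have "(n + 1) * Y \<le> (n + 1) * (I n + S n)"
    "(n + 1) * (I n + S n) \<le> (n + 1) * (Y + n + 2 * k)"
    by (intro mult_left_mono; simp)+
  then show "(n + 1) * Y \<le> 2 * I 0 + n * (n + 1)" "2 * I 0 \<le> (n + 1) * (Y + n + 2 * k)"
    using potential_bounds[of n] by linarith+
qed

end

section \<open>Wallis products\<close>

text \<open>This is \<open>4 ^ k\<close> divided by the central binomial coefficient
  \<open>2 * k\<close> over \<open>k\<close>.\<close>

definition wal :: "nat \<Rightarrow> real" where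
  "wal k = (\<Prod>l=1..k. 2 * real l / (2 * real l - 1))"

lemma wal_0 [simp]: "wal 0 = 1"
  by (simp add: wal_def)

lemma wal_Suc: "wal (Suc k) = wal k * (2 * real k + 2) / (2 * real k + 1)"
  by (simp add: wal_def algebra_simps)

lemma wal_pos: "wal k > 0"
  by (induction k) (simp_all add: wal_Suc)

definition wallis_prod :: "nat \<Rightarrow> real" where
  "wallis_prod k = (\<Prod>l=1..k. (4 * real l ^ 2) / (4 * real l ^ 2 - 1))"

lemma wallis_prod_Suc:
  "wallis_prod (Suc k) =
    wallis_prod k * ((2 * real k + 2)\<^sup>2 / ((2 * real k + 1) * (2 * real k + 3)))"
proof -
  have "4 * (real (Suc k))\<^sup>2 - 1 = (2 * real k + 1) * (2 * real k + 3)"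
    and "4 * (real (Suc k))\<^sup>2 = (2 * real k + 2)\<^sup>2"
    by (simp_all add: power2_eq_square algebra_simps)
  then show ?thesis by (simp add: wallis_prod_def)
qed

lemma wallis_prod_pos: "wallis_prod k > 0"
proof (induction k)
  case 0
  then show ?case by (simp add: wallis_prod_def)
next
  case (Suc k)
  then show ?case unfolding wallis_prod_Suc by (intro mult_pos_pos divide_pos_pos) auto
qed

text \<open>The squared factor of \<open>wal\<close> is the Wallis factor times
  \<open>(2 * l + 1) / (2 * l - 1)\<close>, and the latter telescopes.\<close>

lemma wal_sq_eq: "(wal k)\<^sup>2 = (2 * real k + 1) * wallis_prod k"
proof (induction k)
  case 0
  then show ?case by (simp add: wallis_prod_def)
next
  case (Suc k)
  define a c where "a = 2 * real k + 1" and "c = (2 * real k + 2)\<^sup>2"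
  have "a > 0" unfolding a_def by simp
  have "(wal (Suc k))\<^sup>2 = a * wallis_prod k * c / a\<^sup>2"
    by (simp only: wal_Suc power_mult_distrib power_divide Suc a_def c_def)
  also have "\<dots> = (a + 2) * (wallis_prod k * (c / (a * (a + 2))))"
    using \<open>a > 0\<close> by (simp add: power2_eq_square)
  finally show ?case unfolding wallis_prod_Suc a_def c_def by (simp add: add.commute)
qed

lemma wal_sq_bounds:
  assumes "k > 0"
  shows "pi * real k \<le> (wal k)\<^sup>2" "(wal k)\<^sup>2 \<le> pi * real k + pi / 2"
proof -
  let ?P = wallis_prod
  have lim: "?P \<longlonglongrightarrow> pi / 2" unfolding wallis_prod_def by (rule wallis)
  have "incseq ?P"
  proof (rule incseq_SucI)
    fix k
    have "0 < (2 * real k + 1) * (2 * real k + 3)" by (intro mult_pos_pos) auto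
    moreover have "(2 * real k + 1) * (2 * real k + 3) \<le> (2 * real k + 2)\<^sup>2"
      by (simp add: power2_eq_square algebra_simps)
    ultimately have *: "1 \<le> (2 * real k + 2)\<^sup>2 / ((2 * real k + 1) * (2 * real k + 3))"
      by (simp only: le_divide_eq_1_pos)
    show "?P k \<le> ?P (Suc k)"
      using mult_left_mono[OF * less_imp_le[OF wallis_prod_pos[of k]]]
      unfolding wallis_prod_Suc by (simp only: mult_1_right)
  qed
  then have "?P k \<le> pi / 2" using lim by (rule incseq_le)
  then have "(2 * real k + 1) * ?P k \<le> (2 * real k + 1) * (pi / 2)"
    by (intro mult_left_mono) auto
  then show "(wal k)\<^sup>2 \<le> pi * real k + pi / 2" by (simp add: wal_sq_eq algebra_simps)
  \<comment> \<open>The Wallis products increase to \<open>pi / 2\<close>; this correction decreases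
    to the same limit and gives the lower bound. The index is shifted to avoid a zero
    denominator.\<close>
  define Q where "Q k = ?P (Suc k) * ((2 * real k + 3) / (2 * real k + 2))" for k :: nat
  have "decseq Q"
  proof (rule decseq_SucI)
    fix k
    define a where "a = 2 * real k + 3"
    have a: "a > 1" unfolding a_def by simp
    have "Q (Suc k) = ?P (Suc k) * ((a + 1)\<^sup>2 / (a * (a + 2))) * ((a + 2) / (a + 1))"
      unfolding Q_def wallis_prod_Suc[of "Suc k"] a_def by (simp add: algebra_simps)
    also have "\<dots> = ?P (Suc k) * ((a + 1) / a)"
      using a by (simp add: power2_eq_square)
    also have "\<dots> \<le> ?P (Suc k) * (a / (a - 1))"
      using a less_imp_le[OF wallis_prod_pos]
      by (intro mult_left_mono) (simp_all add: field_simps)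
    also have "\<dots> = Q k" unfolding Q_def a_def by simp
    finally show "Q (Suc k) \<le> Q k" .
  qed
  moreover have "Q \<longlonglongrightarrow> pi / 2 * 1"
  proof -
    have "(\<lambda>k. (2 * real k + 3) / (2 * real k + 2)) \<longlonglongrightarrow> 1" by real_asymp
    then show ?thesis unfolding Q_def by (intro tendsto_mult LIMSEQ_Suc lim)
  qed
  ultimately have "pi / 2 \<le> Q (k - 1)" using decseq_ge[of Q "pi / 2"] by simp
  moreover have "Q (k - 1) * (2 * real k) = (wal k)\<^sup>2"
    using assms unfolding Q_def wal_sq_eq by simp
  ultimately show "pi * real k \<le> (wal k)\<^sup>2"
    using assms mult_right_mono[of "pi / 2" "Q (k - 1)" "2 * real k"] by simp
qed

section \<open>Rounding error in the switch recursion\<close>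

lemma real_div_bounds:
  fixes a m :: nat
  assumes "m > 0"
  shows "real (a div m) \<le> real a / real m" "real a / real m \<le> real (a div m) + 1"
proof -
  show "real (a div m) \<le> real a / real m" by (rule of_nat_div_le_of_nat)
  have "a \<le> (a div m + 1) * m"
    using dividend_less_times_div[OF assms, of a] by (simp add: algebra_simps)
  then have "real a \<le> (real (a div m) + 1) * real m"
    by (metis of_nat_1 of_nat_add of_nat_le_iff of_nat_mult)
  then show "real a / real m \<le> real (a div m) + 1"
    using assms by (simp add: pos_divide_le_eq)
qed

text \<open>\<open>y\<close> solves the recursion without rounding, the Wallis product changing only
  at every second index. The error at index \<open>m + 1\<close> is at most that at
  \<open>m - 1\<close>, plus 1 inherited through the quotient, plus 1 for truncation, so it stays
  within the index.\<close>

lemma switch_bounds: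
  fixes i j k :: nat
  defines "y \<equiv> \<lambda>m k. real m * real j / wal k + real i * wal k"
  shows "real (switch i (i + j) (2 * k)) \<le> y (2 * k) k
    \<and> y (2 * k) k \<le> real (switch i (i + j) (2 * k)) + real (2 * k)
    \<and> real (switch i (i + j) (2 * k + 1)) \<le> y (2 * k + 1) k
    \<and> y (2 * k + 1) k \<le> real (switch i (i + j) (2 * k + 1)) + real (2 * k + 1)"
proof (induction k)
  case 0
  then show ?case by (simp add: y_def)
next
  case (Suc k)
  let ?yitch = "switch i (i + j)"
  have y2: "y (2 * k + 2) (Suc k) = y (2 * k) k + y (2 * k + 1) k / (2 * real k + 1)"
    using wal_pos[of k] unfolding y_def wal_Suc by (simp add: divide_simps) (simp add: algebra_simps)
  have y3: "y (2 * k + 3) (Suc k) = y (2 * k + 1) k + y (2 * k + 2) (Suc k) / (2 * real k + 2)"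
    using wal_pos[of k] unfolding y_def wal_Suc by (simp add: divide_simps) (simp add: algebra_simps)
  have s2: "?yitch (2 * k + 2) = ?yitch (2 * k) + ?yitch (2 * k + 1) div (2 * k + 1)" by simp
  have s3: "?yitch (2 * k + 3) = ?yitch (2 * k + 1) + ?yitch (2 * k + 2) div (2 * k + 2)"
    by (simp add: numeral_3_eq_3)
  have step: "real (a div m) \<le> b / real m \<and> b / real m \<le> real (a div m) + 2"
    if "m > 0" "real a \<le> b" "b \<le> real a + real m" for a m :: nat and b
  proof -
    have "real a / real m \<le> b / real m" "b / real m \<le> (real a + real m) / real m"
      using that by (auto intro: divide_right_mono)
    moreover have "(real a + real m) / real m = real a / real m + 1"
      using that by (simp add: add_divide_distrib)
    ultimately show ?thesis using real_div_bounds[OF that(1), of a] by linarith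
  qed
  have 2: "real (?yitch (2 * k + 2)) \<le> y (2 * k + 2) (Suc k)
    \<and> y (2 * k + 2) (Suc k) \<le> real (?yitch (2 * k + 2)) + real (2 * k + 2)"
    using step[of "2 * k + 1" "?yitch (2 * k + 1)" "y (2 * k + 1) k"] Suc
    unfolding s2 y2 by (simp add: add.commute)
  have 3: "real (?yitch (2 * k + 3)) \<le> y (2 * k + 3) (Suc k)
    \<and> y (2 * k + 3) (Suc k) \<le> real (?yitch (2 * k + 3)) + real (2 * k + 3)"
    using step[of "2 * k + 2" "?yitch (2 * k + 2)" "y (2 * k + 2) (Suc k)"] Suc 2
    unfolding s3 y3 by (simp add: add.commute)
  have "2 * Suc k = 2 * k + 2" "2 * Suc k + 1 = 2 * k + 3" by simp_all
  then show ?case using 2 3 by metis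
qed

section \<open>The asymptotic estimate\<close>

text \<open>Here \<open>y\<^sup>2 / m\<close> is a quadratic form in \<open>i\<close> and
  \<open>j\<close> depending only on \<rho>; its value at \<open>pi / 2\<close> is the target, and
  \<rho> is within \<open>2 / m\<close> of \<open>pi / 2\<close>.\<close>

lemma wallis_form_bounds:
  fixes i j k :: nat
  assumes "k > 0"
  defines "m \<equiv> real (2 * k)" and "N \<equiv> real (i + j + 1)"
  defines "y \<equiv> m * real j / wal k + real i * wal k"
  shows "y\<^sup>2 \<le> 4 * N\<^sup>2 * m"
    "\<bar>y\<^sup>2 / m - (pi * real i + 2 * real j)\<^sup>2 / (2 * pi)\<bar> \<le> 4 * N\<^sup>2 / m"
proof -
  define \<rho> where "\<rho> = (wal k)\<^sup>2 / m"
  have m: "m \<ge> 2" using assms(1) unfolding m_def by simp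
  have pi: "pi \<ge> 2" "pi \<le> 4" using pi_ge_two pi_less_4 by auto
  have \<rho>1: "pi / 2 \<le> \<rho>" 
    using wal_sq_bounds(1)[OF assms(1)] m unfolding \<rho>_def by (simp add: m_def field_simps)
  have "\<rho> \<le> (pi * real k + pi / 2) / m"
    using wal_sq_bounds(2)[OF assms(1)] m unfolding \<rho>_def by (intro divide_right_mono) auto
  also have "\<dots> = pi / 2 + pi / 2 / m"
    using assms(1) unfolding m_def by (simp add: field_simps)
  also have "\<dots> \<le> pi / 2 + 2 / m"
    using m pi by (intro add_left_mono divide_right_mono) auto
  finally have \<rho>2: "\<rho> \<le> pi / 2 + 2 / m" .
  have "2 / m \<le> 1" using m by simp
  then have \<rho>: "1 \<le> \<rho>" "\<rho> \<le> 4" using \<rho>1 \<rho>2 pi by linarith+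
  have y: "y\<^sup>2 / m = (real j)\<^sup>2 / \<rho> + 2 * real i * real j + (real i)\<^sup>2 * \<rho>"
    using wal_pos[of k] m unfolding \<rho>_def y_def
    by (simp add: power2_eq_square divide_simps) (simp add: algebra_simps)
  have "(real j)\<^sup>2 / \<rho> \<le> (real j)\<^sup>2 / 1"
    using \<rho> by (intro divide_left_mono) auto
  also have "\<dots> \<le> 4 * (real j)\<^sup>2" by simp
  finally have "(real j)\<^sup>2 / \<rho> \<le> 4 * (real j)\<^sup>2" .
  moreover have "(real i)\<^sup>2 * \<rho> \<le> 4 * (real i)\<^sup>2"
    using mult_left_mono[OF \<rho>(2), of "(real i)\<^sup>2"] by simp
  moreover have "2 * real i * real j \<le> 4 * (2 * real i * real j)" by simp
  ultimately have "y\<^sup>2 / m \<le> 4 * (real j)\<^sup>2 + 4 * (2 * real i * real j) + 4 * (real i)\<^sup>2"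
    unfolding y by (intro add_mono)
  also have "\<dots> = 4 * (real i + real j)\<^sup>2" unfolding power2_sum by simp
  also have "\<dots> \<le> 4 * N\<^sup>2"
    unfolding N_def by (intro mult_left_mono power_mono) auto
  finally have "y\<^sup>2 / m \<le> 4 * N\<^sup>2" .
  then show "y\<^sup>2 \<le> 4 * N\<^sup>2 * m" using m by (simp add: divide_simps)
  have main: "(pi * real i + 2 * real j)\<^sup>2 / (2 * pi)
      = (real j)\<^sup>2 * (2 / pi) + 2 * real i * real j + (real i)\<^sup>2 * (pi / 2)"
    by (simp add: power2_eq_square field_simps)
  have d: "2 / pi - 1 / \<rho> = (\<rho> - pi / 2) / (pi / 2 * \<rho>)"
    using \<rho> pi by (simp add: field_simps)
  have "0 \<le> 2 / pi - 1 / \<rho>" unfolding d using \<rho>1 \<rho> by simp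
  \<comment> \<open>As \<rho> and \<open>pi / 2\<close> are at least 1, taking reciprocals does not
    enlarge their distance.\<close>
  have "1 * 1 \<le> pi / 2 * \<rho>" using \<rho> pi by (intro mult_mono) auto
  then have "(\<rho> - pi / 2) / (pi / 2 * \<rho>) \<le> (\<rho> - pi / 2) / 1"
    using \<rho>1 by (intro divide_left_mono) auto
  then have d': "2 / pi - 1 / \<rho> \<le> 2 / m" using d \<rho>2 by simp
  have j: "\<bar>(real j)\<^sup>2 * (1 / \<rho> - 2 / pi)\<bar> \<le> N\<^sup>2 * (2 / m)"
    unfolding abs_mult using d' \<open>0 \<le> 2 / pi - 1 / \<rho>\<close> m
    by (intro mult_mono) (auto simp: N_def intro: power_mono)
  have i: "\<bar>(real i)\<^sup>2 * (\<rho> - pi / 2)\<bar> \<le> N\<^sup>2 * (2 / m)"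
    unfolding abs_mult using \<rho>1 \<rho>2 m
    by (intro mult_mono) (auto simp: N_def intro: power_mono)
  have "y\<^sup>2 / m - (pi * real i + 2 * real j)\<^sup>2 / (2 * pi)
      = (real j)\<^sup>2 * (1 / \<rho> - 2 / pi) + (real i)\<^sup>2 * (\<rho> - pi / 2)"
    unfolding y main by (simp add: algebra_simps)
  then show "\<bar>y\<^sup>2 / m - (pi * real i + 2 * real j)\<^sup>2 / (2 * pi)\<bar> \<le> 4 * N\<^sup>2 / m"
    using i j by (simp add: abs_le_iff)
qed

lemma Tchoukaillon_approx:
  fixes i j :: nat
  shows "\<bar>real (Tchoukaillon i j) - (pi * real i + 2 * real j)\<^sup>2 / (4 * pi)\<bar>
    \<le> 20 * real (i + j + 1) powr (4 / 3)"
proof -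
  define N where "N = real (i + j + 1)"
  define u where "u = N powr (1 / 3)"
  \<comment> \<open>Since \<open>u ^ 3 = N\<close>, this puts \<open>m\<close> between
    \<open>2 * u\<^sup>2\<close> and \<open>4 * u\<^sup>2\<close>, and every error term becomes a
    multiple of \<open>u ^ 4\<close>.\<close>
  define k where "k = nat \<lceil>u\<^sup>2\<rceil>"
  define m where "m = real (2 * k)"
  define y where "y = m * real j / wal k + real i * wal k"
  define M where "M = (pi * real i + 2 * real j)\<^sup>2 / (2 * pi)"
  have N: "N \<ge> 1" unfolding N_def by simp
  then have u: "u \<ge> 1" unfolding u_def by (simp add: ge_one_powr_ge_zero)
  have u3: "u ^ 3 = N" and u4: "u ^ 4 = N powr (4 / 3)"
    using N unfolding u_def by (simp_all add: powr_power)
  have u2: "u\<^sup>2 \<ge> 1" using u by simp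
  have "u\<^sup>2 \<le> real k" "real k \<le> u\<^sup>2 + 1" using u2 unfolding k_def by linarith+
  then have k: "k > 0" and m: "2 * u\<^sup>2 \<le> m" "m \<le> 4 * u\<^sup>2"
    using u2 unfolding m_def by (auto intro: gr0I)
  have m0: "m > 0" using m u2 by linarith
  have N2: "N\<^sup>2 = u ^ 6" unfolding u3[symmetric] by simp
  note form = wallis_form_bounds[OF k, of j i, folded m_def N_def, folded y_def M_def]
  have "4 * N\<^sup>2 * m \<le> 4 * u ^ 6 * (4 * u\<^sup>2)"
    unfolding N2 using m by (intro mult_left_mono) auto
  also have "\<dots> = (4 * u ^ 4)\<^sup>2" by (simp add: power_mult_distrib flip: power_add power_mult)
  finally have "y\<^sup>2 \<le> (4 * u ^ 4)\<^sup>2" using form(1) by (rule order_trans[rotated])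
  then have y4: "y \<le> 4 * u ^ 4" by (rule power2_le_imp_le) (use u in simp)
  have "4 * N\<^sup>2 / m \<le> 4 * N\<^sup>2 / (2 * u\<^sup>2)"
    using m m0 u by (intro divide_left_mono mult_pos_pos) auto
  also have "\<dots> = 2 * u ^ 4"
    unfolding N2 using u by (simp add: field_simps flip: power_add)
  finally have yM: "\<bar>y\<^sup>2 / m - M\<bar> \<le> 2 * u ^ 4" using form(2) by linarith
  obtain I S where "sieve I S i (i + j)" using sieve_exists[of i "i + j"] by auto
  then interpret sieve I S i "i + j" .
  have T: "real (Tchoukaillon i j) = real (I 0) + 1" using Tchoukaillon_eq by simp
  define Yn where "Yn = switch i (i + j) (2 * k)"
  define Y where "Y = real Yn"
  define n where "n = real (Yn div (2 * k))"
  have Y: "0 \<le> Y" "Y \<le> y" "y \<le> Y + m"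
    using switch_bounds[of i j k] unfolding Y_def Yn_def y_def m_def by auto
  have n: "0 \<le> n" "n \<le> Y / m" "Y / m \<le> n + 1"
    using real_div_bounds[of "2 * k" Yn] k unfolding n_def Y_def m_def by auto
  have lo: "(n + 1) * Y \<le> 2 * real (I 0) + n * (n + 1)"
    and hi: "2 * real (I 0) \<le> (n + 1) * (Y + n + m)"
    using I_0_approx[OF k, folded Yn_def, THEN of_nat_mono[where 'a = real]]
    unfolding n_def Y_def m_def by (simp_all add: algebra_simps)
  have "Y / m \<le> 4 * u ^ 4 / (2 * u\<^sup>2)"
    using Y y4 m u2 by (intro frac_le) auto
  also have "\<dots> = 2 * u\<^sup>2" using u by (simp add: field_simps flip: power_add)
  finally have n2: "n \<le> 2 * u\<^sup>2" using n by linarith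
  have u22: "u\<^sup>2 * u\<^sup>2 = u ^ 4" by (simp flip: power_add)
  have nn: "n * (n + 1) \<le> 2 * u\<^sup>2 * (3 * u\<^sup>2)"
    using n n2 u2 by (intro mult_mono) auto
  have nm: "(n + 1) * (n + m) \<le> 3 * u\<^sup>2 * (6 * u\<^sup>2)"
    using n n2 u2 m m0 by (intro mult_mono) auto
  have Ylo: "Y\<^sup>2 / m \<le> (n + 1) * Y"
    using mult_right_mono[OF n(3) Y(1)] by (simp add: power2_eq_square)
  have Yhi: "(n + 1) * Y \<le> Y\<^sup>2 / m + Y"
    using mult_right_mono[OF n(2) Y(1)] by (simp add: power2_eq_square algebra_simps)
  have "Y\<^sup>2 \<le> y\<^sup>2" using Y by (intro power_mono) auto
  then have Yy: "Y\<^sup>2 / m \<le> y\<^sup>2 / m" using m0 by (intro divide_right_mono) auto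
  have "(y - Y) * (y + Y) \<le> m * (2 * y)" using Y m0 by (intro mult_mono) auto
  then have "y\<^sup>2 / m \<le> (Y\<^sup>2 + m * (2 * y)) / m"
    using m0 by (intro divide_right_mono) (auto simp: power2_eq_square algebra_simps)
  also have "\<dots> = Y\<^sup>2 / m + 2 * y" using m0 by (simp add: add_divide_distrib)
  finally have yY: "y\<^sup>2 / m \<le> Y\<^sup>2 / m + 2 * y" .
  \<comment> \<open>The 24 is 2 from \<open>yM\<close>, 4 from \<open>Y \<le> y\<close> and 18 from
    \<open>nm\<close>.\<close>
  have up: "2 * real (I 0) \<le> M + 24 * u ^ 4"
    using hi Yhi Yy yM nm y4 Y u22 by (simp add: algebra_simps)
  \<comment> \<open>The 16 is 2 from \<open>yM\<close>, 8 from \<open>2 * y\<close> and 6 from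
    \<open>nn\<close>.\<close>
  have low: "M - 16 * u ^ 4 \<le> 2 * real (I 0)"
    using lo Ylo yY yM nn y4 u22 by (simp add: algebra_simps)
  have "(pi * real i + 2 * real j)\<^sup>2 / (4 * pi) = M / 2" unfolding M_def by simp
  moreover have "1 \<le> u ^ 4" using u by simp
  ultimately show ?thesis
    unfolding T N_def[symmetric] u4[symmetric] using up low by (simp add: abs_le_iff)
qed

text \<open>The quadratic terms cancel and leave a linear term of size at most
  \<open>N = i + j + 1\<close>.\<close>

lemma shifted_square_diff:
  fixes i j :: nat
  shows "\<bar>(pi * real i + 2 * real j + 2)\<^sup>2 / (4 * pi) - (pi * real i + 2 * real j)\<^sup>2 / (4 * pi)\<bar>
    \<le> real (i + j + 1) powr (4 / 3)"
proof -
  have "(pi * real i + 2 * real j + 2)\<^sup>2 / (4 * pi) - (pi * real i + 2 * real j)\<^sup>2 / (4 * pi)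
      = real i + 2 / pi * real j + 1 / pi"
    by (simp add: field_simps power2_eq_square)
  moreover have "2 / pi * real j \<le> 1 * real j"
    using pi_ge_two by (intro mult_right_mono) auto
  moreover have "1 / pi \<le> 1" "0 \<le> 1 / pi" "0 \<le> 2 / pi * real j"
    using pi_ge_two by auto
  moreover have "real (i + j + 1) powr 1 = real i + real j + 1" by simp
  ultimately have "\<bar>(pi * real i + 2 * real j + 2)\<^sup>2 / (4 * pi)
      - (pi * real i + 2 * real j)\<^sup>2 / (4 * pi)\<bar> \<le> real (i + j + 1) powr 1"
    by linarith
  also have "\<dots> \<le> real (i + j + 1) powr (4 / 3)" by (intro powr_mono) auto
  finally show ?thesis .
qed

theorem theorem1:
  shows "(\<exists>C::real. \<forall>i j :: nat.
            \<bar>real (Tchoukaillon i j) - (pi * real i + 2 * real j + 2)\<^sup>2 / (4 * pi)\<bar>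
              \<le> C * real (i + j + 1) powr (4 / 3))
       \<and> (\<lambda>(i, j). real (Tchoukaillon i j) - (pi * real i + 2 * real j)\<^sup>2 / (4 * pi))
            \<in> o[filtercomap (\<lambda>(i, j). i + j + 1) at_top](\<lambda>(i, j). (real (i + j + 1))\<^sup>2)"
proof (intro conjI exI allI)
  fix i j :: nat
  show "\<bar>real (Tchoukaillon i j) - (pi * real i + 2 * real j + 2)\<^sup>2 / (4 * pi)\<bar>
      \<le> 21 * real (i + j + 1) powr (4 / 3)"
    using Tchoukaillon_approx[of i j] shifted_square_diff[of i j] by linarith
next
  show "(\<lambda>(i, j). real (Tchoukaillon i j) - (pi * real i + 2 * real j)\<^sup>2 / (4 * pi))
      \<in> o[filtercomap (\<lambda>(i, j). i + j + 1) at_top](\<lambda>(i, j). (real (i + j + 1))\<^sup>2)"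
  proof (rule landau_o.smallI)
    fix c :: real
    assume "c > 0"
    \<comment> \<open>A one-variable comparison suffices, as the filter is pulled back along
      \<open>i + j + 1\<close>.\<close>
    have "(\<lambda>N. 20 * real N powr (4 / 3)) \<in> o(\<lambda>N. (real N)\<^sup>2)" by real_asymp
    from landau_o.smallD[OF this \<open>c > 0\<close>]
    have "eventually (\<lambda>N. 20 * real N powr (4 / 3) \<le> c * (real N)\<^sup>2) at_top" by simp
    then have "eventually (\<lambda>(i, j). 20 * real (i + j + 1) powr (4 / 3) \<le> c * (real (i + j + 1))\<^sup>2)
        (filtercomap (\<lambda>(i, j). i + j + 1) at_top)"
      by (rule eventually_mono[OF eventually_filtercomapI]) auto
    then show "eventually (\<lambda>p.
        norm (case p of (i, j) \<Rightarrow> real (Tchoukaillon i j) - (pi * real i + 2 * real j)\<^sup>2 / (4 * pi))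
        \<le> c * norm (case p of (i, j) \<Rightarrow> (real (i + j + 1))\<^sup>2))
        (filtercomap (\<lambda>(i, j). i + j + 1) at_top)"
    proof (rule eventually_mono, clarify)
      fix i j :: nat
      assume "20 * real (i + j + 1) powr (4 / 3) \<le> c * (real (i + j + 1))\<^sup>2"
      with Tchoukaillon_approx[of i j]
      show "norm (real (Tchoukaillon i j) - (pi * real i + 2 * real j)\<^sup>2 / (4 * pi))
          \<le> c * norm ((real (i + j + 1))\<^sup>2)"
        by simp
    qed
  qed
qed

end
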